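(* Let $D=(V,A)$ be a digraph. (a) With $\varphi(\sigma):=\sum_{\gamma}(\ell(\gamma)-1)$ for $\sigma\in\mathfrak{S}_V$ (sum over the cycles $\gamma$ of $\sigma$ that are $D$-cycles), we have \[\#\{\text{hamps of }\overline{D}\}=\sum_{\sigma\in\mathfrak{S}_V(D,\overline{D})}(-1)^{\varphi(\sigma)}.\] (b) $\#\{\text{hamps of }\overline{D}\}\equiv|\mathfrak{S}_V(D,\overline{D})|\pmod 2$.
   Context: A digraph is $D=(V,A)$ with $V$ finite and $A\subseteq V\times V$; $\overline{D}=(V,(V\times V)\setminus A)$. For a digraph $E=(V,B)$ an $E$-path is a nonempty tuple $v=(v_1,\dots,v_k)$ of distinct elements of $V$ with $(v_i,v_{i+1})\in B$ for all $i\in[k-1]$; a hamp of $E$ is an $E$-path containing every vertex; by convention, when $V=\varnothing$ the empty list counts as a hamp. The cycles of $\sigma\in\mathfrak{S}_V$ are the rotation-equivalence classes (under cyclic rotation) of tuples $(i,\sigma(i),\dots,\sigma^{k-1}(i))$ with $k$ minimal such that $\sigma^k(i)=i$; $\ell(\gamma)$ is the length of its tuples; for the class $\gamma$ of $(v_1,\dots,v_k)$, $\operatorname{CArcs}\gamma=\{(v_1,v_2),\dots,(v_{k-1},v_k),(v_k,v_1)\}$. A $D$-cycle is a rotation-equivalence class $\gamma$ of nonempty tuples of distinct elements of $V$ with $\operatorname{CArcs}\gamma\subseteq A$ (analogously $\overline{D}$-cycle). $\mathfrak{S}_V(D,\overline{D})$ is the set of $\sigma\in\mathfrak{S}_V$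 all of whose cycles are $D$-cycles or $\overline{D}$-cycles. *)

theory Defs
  imports
    "Graph_Theory.Pair_Digraph"
    "Graph_Theory.Vertex_Walk"
    "HOL-Combinatorics.Cycles"
    "HOL-Number_Theory.Cong"
begin

text \<open>
  A digraph with finite vertex set and arcs contained in \<open>V \<times> V\<close> (loops allowed, no
  multiple arcs) is a \<^const>\<open>pair_fin_digraph\<close>, and a path in such a digraph is a list
  satisfying \<^const>\<open>vpath\<close>, which by definition is nonempty.
\<close>

definition compl_digraph :: "'a pair_pre_digraph \<Rightarrow> 'a pair_pre_digraph" where
  "compl_digraph D =
     \<lparr>pverts = pverts D, parcs = (pverts D \<times> pverts D) - parcs D\<rparr>"

lemma pair_fin_digraph_compl:
  "pair_fin_digraph D \<Longrightarrow> pair_fin_digraph (compl_digraph D)"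
  unfolding pair_fin_digraph_def pair_wf_digraph_def pair_fin_digraph_axioms_def
  by (auto simp: compl_digraph_def)

definition hamp :: "'a pair_pre_digraph \<Rightarrow> 'a list \<Rightarrow> bool" where
  "hamp E v \<longleftrightarrow>
     (vpath v (with_proj E) \<and> pverts E \<subseteq> set v) \<or> (pverts E = {} \<and> v = [])"

definition rot_class :: "'a list \<Rightarrow> 'a list set" where
  "rot_class v = range (\<lambda>n. rotate n v)"

text \<open>
  The length and the cyclic arcs of a rotation class are those of any of its members; the two
  lemmas below show independence of the representative.
\<close>

definition class_length :: "'a list set \<Rightarrow> nat" where
  "class_length \<gamma> = the_elem (length ` \<gamma>)"

definition CArcs :: "'a list set \<Rightarrow> ('a \<times> 'a) set" where
  "CArcs \<gamma> = the_elem ((\<lambda>v. set (zip v (rotate1 v))) ` \<gamma>)"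

lemma class_length_rot_class: "class_length (rot_class v) = length v"
proof -
  have "length ` rot_class v = {length v}"
    by (auto simp: rot_class_def image_image)
  then show ?thesis
    by (simp add: class_length_def)
qed

lemma CArcs_rot_class: "CArcs (rot_class v) = set (zip v (rotate1 v))"
proof -
  have zip_rotate1: "zip (rotate1 xs) (rotate1 ys) = rotate1 (zip xs ys)"
    if "length xs = length ys" for xs ys :: "'a list"
    using that by (cases xs; cases ys) simp_all
  have step: "set (zip (rotate1 w) (rotate1 (rotate1 w))) = set (zip w (rotate1 w))"
    for w :: "'a list"
    by (simp add: zip_rotate1)
  have "set (zip (rotate n v) (rotate1 (rotate n v))) = set (zip v (rotate1 v))" for n
    by (induction n) (simp_all add: step)
  then have "(\<lambda>w. set (zip w (rotate1 w))) ` rot_class v = {set (zip v (rotate1 v))}"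
    by (auto simp: rot_class_def)
  then show ?thesis
    by (simp add: CArcs_def)
qed

definition digraph_cycle :: "'a pair_pre_digraph \<Rightarrow> 'a list set \<Rightarrow> bool" where
  "digraph_cycle E \<gamma> \<longleftrightarrow>
     (\<exists>v. v \<noteq> [] \<and> distinct v \<and> set v \<subseteq> pverts E \<and> \<gamma> = rot_class v) \<and> CArcs \<gamma> \<subseteq> parcs E"

text \<open>
  \<open>support \<sigma> i\<close> is the list \<open>[i, \<sigma> i, \<dots>, (\<sigma> ^^ (k - 1)) i]\<close> with \<open>k > 0\<close> minimal such that
  \<open>(\<sigma> ^^ k) i = i\<close>. A fixed point of \<open>\<sigma>\<close> in \<open>V\<close> yields a cycle of length 1.
\<close>

definition perm_cycles :: "'a set \<Rightarrow> ('a \<Rightarrow> 'a) \<Rightarrow> 'a list set set" where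
  "perm_cycles V \<sigma> = (\<lambda>i. rot_class (support \<sigma> i)) ` V"

definition DDbar_perms :: "'a pair_pre_digraph \<Rightarrow> ('a \<Rightarrow> 'a) set" where
  "DDbar_perms D = {\<sigma>. \<sigma> permutes pverts D \<and>
     (\<forall>\<gamma>\<in>perm_cycles (pverts D) \<sigma>.
        digraph_cycle D \<gamma> \<or> digraph_cycle (compl_digraph D) \<gamma>)}"

definition phi :: "'a pair_pre_digraph \<Rightarrow> ('a \<Rightarrow> 'a) \<Rightarrow> nat" where
  "phi D \<sigma> =
     (\<Sum>\<gamma> | \<gamma> \<in> perm_cycles (pverts D) \<sigma> \<and> digraph_cycle D \<gamma>. class_length \<gamma> - 1)"

end

theory Submission
  imports Defs "HOL-Combinatorics.Multiset_Permutations"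
begin

text \<open>
  Inclusion-exclusion over the arcs of \<open>D\<close> used by a linear order of the vertices expresses the
  number of hamps of the complement as the sum of \<open>(-1)\<^bsup>|F|\<^esup>\<close> times the number of linear orders
  containing \<open>F\<close>, over all \<open>F \<subseteq> A\<close>. No linear order contains a cyclic \<open>F\<close>, and an acyclic \<open>F\<close> is
  contained in exactly as many linear orders as permutations. Exchanging the two sums again, each
  permutation \<open>\<sigma>\<close> contributes the signed sum over those sets of \<open>D\<close>-arcs of \<open>\<sigma>\<close> that contain no full
  cycle of \<open>\<sigma>\<close>. It factors over the cycles: a \<open>D\<close>-cycle of length \<open>l\<close> contributes \<open>(-1)\<^bsup>l-1\<^esup>\<close>, a cycle
  of the complement contributes 1, and any other cycle contributes 0.
\<close>

section \<open>Linear orders and permutations containing a given arc set\<close>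

abbreviation list_arcs :: "'a list \<Rightarrow> ('a \<times> 'a) set" where
  "list_arcs xs \<equiv> set (vwalk_arcs xs)"

text \<open>A permutation of \<open>V\<close> fixes every point outside \<open>V\<close>. Taking
  tails in \<open>V\<close> only discards those loops, while fixed points in \<open>V\<close> keep
  theirs.\<close>

definition perm_arcs :: "'a set \<Rightarrow> ('a \<Rightarrow> 'a) \<Rightarrow> ('a \<times> 'a) set" where
  "perm_arcs V \<sigma> = (\<lambda>x. (x, \<sigma> x)) ` V"

text \<open>The two pieces overlap in \<open>x\<close>, so the arcs into and out of \<open>x\<close>
  both survive the cut.\<close>

lemma list_arcs_split:
  "list_arcs (as @ x # bs) = list_arcs (as @ [x]) \<union> list_arcs (x # bs)"
proof (induction as)
  case (Cons a as)
  then show ?case by (cases as) auto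
qed simp

lemma list_arcs_subset: "list_arcs xs \<subseteq> set xs \<times> set xs"
  by (induction xs rule: vwalk_arcs.induct) auto

lemma list_arcsE:
  assumes "(x, y) \<in> list_arcs xs"
  obtains as bs where "xs = as @ x # y # bs"
proof -
  have "\<exists>as bs. xs = as @ x # y # bs"
    using assms
  proof (induction xs rule: vwalk_arcs.induct)
    case (3 a b xs)
    show ?case
    proof (cases "(x, y) = (a, b)")
      case True
      then show ?thesis by blast
    next
      case False
      then obtain as bs where "b # xs = as @ x # y # bs"
        using 3 by auto
      then have "a # b # xs = (a # as) @ x # y # bs" by simp
      then show ?thesis by blast
    qed
  qed simp_all
  then show thesis using that by blast
qed

lemma list_arcs_functional:
  assumes "distinct xs" "(x, y) \<in> list_arcs xs" "(x, z) \<in> list_arcs xs"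
  shows "y = z"
proof -
  obtain as bs where 1: "xs = as @ x # y # bs" using assms(2) by (rule list_arcsE)
  obtain cs ds where 2: "xs = cs @ x # z # ds" using assms(3) by (rule list_arcsE)
  have "x \<notin> set as" "x \<notin> set (y # bs)" using assms(1) 1 by auto
  then have "y # bs = z # ds" using 1 2 append_Cons_eq_iff by metis
  then show ?thesis by simp
qed

lemma list_arcs_injective:
  assumes "distinct xs" "(x, z) \<in> list_arcs xs" "(y, z) \<in> list_arcs xs"
  shows "x = y"
proof -
  obtain as bs where "xs = as @ x # z # bs" using assms(2) by (rule list_arcsE)
  then have 1: "xs = (as @ [x]) @ z # bs" by simp
  obtain cs ds where "xs = cs @ y # z # ds" using assms(3) by (rule list_arcsE)
  then have 2: "xs = (cs @ [y]) @ z # ds" by simp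
  have "z \<notin> set (as @ [x])" "z \<notin> set bs" using assms(1) 1 by auto
  then have "as @ [x] = cs @ [y]" using 1 2 append_Cons_eq_iff by metis
  then show ?thesis by simp
qed

lemma acyclic_list_arcs: "distinct xs \<Longrightarrow> acyclic (list_arcs xs)"
proof (induction xs rule: vwalk_arcs.induct)
  case (3 x y xs)
  \<comment> \<open>The head \<open>x\<close> does not recur in \<open>y # xs\<close>, so no arc
    there enters it, and adding \<open>(x, y)\<close> closes no cycle.\<close>
  have "(y, x) \<notin> (list_arcs (y # xs))\<^sup>*"
  proof
    assume "(y, x) \<in> (list_arcs (y # xs))\<^sup>*"
    then have "x = y \<or> x \<in> Range (list_arcs (y # xs))"
      by (auto elim: rtranclE)
    then show False
      using 3(2) list_arcs_subset[of "y # xs"] by auto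
  qed
  then show ?case
    using 3 by (simp del: vwalk_arcs_Cons add: acyclic_insert)
qed (simp_all add: acyclic_def)

text \<open>Deleting \<open>w\<close> is a bijection whose inverse inserts \<open>w\<close> directly
  after \<open>u\<close>. This contracts the arc \<open>(u, w)\<close> and leaves the arcs of
  \<open>F\<close> alone.\<close>

lemma card_lists_insert_arc:
  fixes F :: "('a \<times> 'a) set"
  assumes "u \<in> V" "w \<in> V" "u \<noteq> w" "F \<subseteq> (V - {w}) \<times> (V - {w})" "u \<notin> Domain F"
  shows "card {xs \<in> permutations_of_set V. insert (u, w) F \<subseteq> list_arcs xs}
       = card {ys \<in> permutations_of_set (V - {w}). F \<subseteq> list_arcs ys}"
    (is "card ?X = card ?Y")
proof -
  \<comment> \<open>Apart from \<open>(u, w)\<close>, which enters \<open>w\<close>, the two lists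
    differ only in the arc to the first vertex of \<open>bs\<close>; its tail is \<open>w\<close> or
    \<open>u\<close>, and \<open>F\<close> has no arc leaving either.\<close>
  have arcs: "F \<subseteq> list_arcs (as @ u # w # bs) \<longleftrightarrow> F \<subseteq> list_arcs (as @ u # bs)" for as bs
  proof -
    have "list_arcs (as @ u # w # bs)
        = list_arcs (as @ [u]) \<union> {(u, w)} \<union> list_arcs (w # bs)"
      by (subst list_arcs_split) auto
    moreover have "list_arcs (as @ u # bs) = list_arcs (as @ [u]) \<union> list_arcs (u # bs)"
      by (rule list_arcs_split)
    ultimately show ?thesis
      using assms(4,5) by (cases bs) (auto simp: Domain_iff)
  qed
  have split: "\<exists>as bs. xs = as @ u # w # bs \<and> u \<notin> set as \<and> u \<notin> set bs
      \<and> w \<notin> set as \<and> w \<notin> set bs" if "xs \<in> ?X" for xs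
  proof -
    have "(u, w) \<in> list_arcs xs" using that by auto
    then obtain as bs where "xs = as @ u # w # bs" by (rule list_arcsE)
    then show ?thesis using that by (auto simp: permutations_of_set_def)
  qed
  have "bij_betw (removeAll w) ?X ?Y"
    unfolding bij_betw_def
  proof
    show "inj_on (removeAll w) ?X"
    proof (rule inj_onI)
      fix xs ys assume "xs \<in> ?X" "ys \<in> ?X" and eq: "removeAll w xs = removeAll w ys"
      from split[OF \<open>xs \<in> ?X\<close>] split[OF \<open>ys \<in> ?X\<close>] obtain as bs cs ds
        where "xs = as @ u # w # bs" "u \<notin> set as" "u \<notin> set bs" "w \<notin> set as" "w \<notin> set bs"
          "ys = cs @ u # w # ds" "u \<notin> set cs" "u \<notin> set ds" "w \<notin> set cs" "w \<notin> set ds"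
        by blast
      then show "xs = ys"
        using eq assms(3) by (auto simp: append_Cons_eq_iff)
    qed
    show "removeAll w ` ?X = ?Y"
    proof (intro equalityI subsetI)
      fix ys assume "ys \<in> removeAll w ` ?X"
      then obtain xs where xs: "xs \<in> ?X" "ys = removeAll w xs" by blast
      with split obtain as bs where "xs = as @ u # w # bs" "w \<notin> set as" "w \<notin> set bs"
        by blast
      then show "ys \<in> ?Y"
        using xs assms(3) arcs[of as bs] by (auto simp: permutations_of_set_def)
    next
      fix ys assume ys: "ys \<in> ?Y"
      then have "u \<in> set ys" using assms by (auto simp: permutations_of_set_def)
      then obtain as bs where ab: "ys = as @ u # bs" by (auto simp: in_set_conv_decomp)
      have "w \<notin> set as" "w \<notin> set bs"
        using ys ab by (auto simp: permutations_of_set_def)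
      moreover have "(u, w) \<in> list_arcs (as @ u # w # bs)"
        by (subst list_arcs_split) auto
      ultimately have "as @ u # w # bs \<in> ?X" "ys = removeAll w (as @ u # w # bs)"
        using ys ab arcs[of as bs] assms by (auto simp: permutations_of_set_def)
      then show "ys \<in> removeAll w ` ?X" by blast
    qed
  qed
  then show ?thesis by (rule bij_betw_same_card)
qed

text \<open>Precomposing with the transposition of \<open>u\<close> and \<open>w\<close> cuts
  \<open>w\<close> out of its cycle: \<open>w\<close> becomes a fixed point and \<open>u\<close> is
  sent to the old image of \<open>w\<close>. Only the values at \<open>u\<close> and
  \<open>w\<close> change, and neither is a tail in \<open>F\<close>. The operation is its own
  inverse.\<close>

lemma card_perms_insert_arc:
  fixes F :: "('a \<times> 'a) set"
  assumes "u \<in> V" "w \<in> V" "u \<noteq> w" "F \<subseteq> (V - {w}) \<times> (V - {w})" "u \<notin> Domain F"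
  shows "card {\<sigma>. \<sigma> permutes V \<and> insert (u, w) F \<subseteq> perm_arcs V \<sigma>}
       = card {\<tau>. \<tau> permutes (V - {w}) \<and> F \<subseteq> perm_arcs (V - {w}) \<tau>}"
    (is "card ?X = card ?Y")
proof -
  let ?t = "transpose u w"
  have arcs: "F \<subseteq> perm_arcs V \<sigma> \<longleftrightarrow> F \<subseteq> perm_arcs (V - {w}) (\<sigma> \<circ> ?t)" for \<sigma>
  proof -
    have "(x, y) \<in> perm_arcs V \<sigma> \<longleftrightarrow> (x, y) \<in> perm_arcs (V - {w}) (\<sigma> \<circ> ?t)"
      if "(x, y) \<in> F" for x y
    proof -
      have "x \<noteq> u" "x \<noteq> w" "x \<in> V" using that assms(4,5) by auto
      then show ?thesis by (auto simp: perm_arcs_def transpose_def)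
    qed
    then show ?thesis by (auto 4 4)
  qed
  have t: "?t permutes V" using assms by (simp add: permutes_swap_id)
  have invol: "\<sigma> \<circ> ?t \<circ> ?t = \<sigma>" for \<sigma> :: "'a \<Rightarrow> 'a" by (simp add: comp_assoc)
  have "bij_betw (\<lambda>\<sigma>. \<sigma> \<circ> ?t) ?X ?Y"
  proof (rule bij_betwI[where g = "\<lambda>\<sigma>. \<sigma> \<circ> ?t"])
    show "(\<lambda>\<sigma>. \<sigma> \<circ> ?t) \<in> ?X \<rightarrow> ?Y"
    proof
      fix \<sigma> assume \<sigma>: "\<sigma> \<in> ?X"
      then have "\<sigma> u = w" by (auto simp: perm_arcs_def)
      then have "(\<sigma> \<circ> ?t) w = w" by simp
      then have "(\<sigma> \<circ> ?t) x = x" if "x \<in> V - (V - {w})" for x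
        using that by blast
      moreover have "\<sigma> \<circ> ?t permutes V" using \<sigma> t by (blast intro: permutes_compose)
      ultimately have "\<sigma> \<circ> ?t permutes (V - {w})"
        by (rule permutes_superset[rotated])
      then show "\<sigma> \<circ> ?t \<in> ?Y" using \<sigma> arcs by auto
    qed
    show "(\<lambda>\<sigma>. \<sigma> \<circ> ?t) \<in> ?Y \<rightarrow> ?X"
    proof
      fix \<tau> assume \<tau>: "\<tau> \<in> ?Y"
      then have "\<tau> w = w" by (auto simp: permutes_def)
      then have "(u, w) \<in> perm_arcs V (\<tau> \<circ> ?t)"
        using assms(1) by (auto simp: perm_arcs_def image_iff)
      moreover have "\<tau> permutes V" using \<tau> by (auto intro: permutes_subset)
      then have "\<tau> \<circ> ?t permutes V" using t by (auto intro: permutes_compose)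
      moreover have "F \<subseteq> perm_arcs V (\<tau> \<circ> ?t)"
        using \<tau> arcs[of "\<tau> \<circ> ?t"] by (simp add: invol)
      ultimately show "\<tau> \<circ> ?t \<in> ?X" by auto
    qed
  qed (simp_all add: invol)
  then show ?thesis by (rule bij_betw_same_card)
qed

text \<open>Induction on \<open>card V\<close>. For empty \<open>F\<close> both sides are the
  factorial of \<open>card V\<close>; otherwise contracting one arc shrinks both sides alike, unless
  both counts are zero.\<close>

lemma card_lists_eq_card_perms:
  fixes F :: "('a \<times> 'a) set"
  assumes "finite V" "F \<subseteq> V \<times> V" "acyclic F"
  shows "card {xs \<in> permutations_of_set V. F \<subseteq> list_arcs xs}
       = card {\<sigma>. \<sigma> permutes V \<and> F \<subseteq> perm_arcs V \<sigma>}"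
  using assms
proof (induction "card V" arbitrary: V F rule: less_induct)
  case less
  have finF: "finite F" using less.prems by (meson finite_SigmaI finite_subset)
  show ?case
  proof (cases "F = {}")
    case True
    then show ?thesis using less.prems by (simp add: card_permutations)
  next
    case False
    \<comment> \<open>A minimal element of \<open>Range F\<close> for the converse relation has no
      out-neighbour in \<open>Range F\<close>, hence none at all.\<close>
    have "wf (F\<inverse>)" using finF less.prems(3) by (rule finite_acyclic_wf_converse)
    moreover have "Range F \<noteq> {}" using False by auto
    \<comment> \<open>A sink \<open>w\<close> that is the head of some arc \<open>(u, w)\<close>: deleting \<open>w\<close> from both kinds of
      objects removes exactly this arc from \<open>F\<close>.\<close>
    ultimately obtain w where w: "w \<in> Range F" "\<And>y. (w, y) \<notin> F"
      by (metis Range.intros converse.intros ex_in_conv wfE_min)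
    then obtain u where u: "(u, w) \<in> F" by auto
    then have uw: "u \<in> V" "w \<in> V" "u \<noteq> w" using less.prems w by auto
    define F' where "F' = F - {(u, w)}"
    have F: "F = insert (u, w) F'" using u by (auto simp: F'_def)
    show ?thesis
    proof (cases "u \<in> Domain F' \<or> w \<in> Range F'")
      case True
      \<comment> \<open>A second arc with tail \<open>u\<close> or head \<open>w\<close> makes both
        counts zero: distinct lists and permutations alike allow each vertex at most one successor
        and one predecessor.\<close>
      then consider y where "(u, y) \<in> F" "y \<noteq> w" | y where "(y, w) \<in> F" "y \<noteq> u"
        by (auto simp: F'_def)
      then have "{xs \<in> permutations_of_set V. F \<subseteq> list_arcs xs} = {}
          \<and> {\<sigma>. \<sigma> permutes V \<and> F \<subseteq> perm_arcs V \<sigma>} = {}"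
      proof cases
        case 1
        then show ?thesis
          using u by (auto simp: permutations_of_set_def perm_arcs_def
              dest: list_arcs_functional)
      next
        case 2
        have "\<not> F \<subseteq> perm_arcs V \<sigma>" if "\<sigma> permutes V" for \<sigma>
        proof
          assume "F \<subseteq> perm_arcs V \<sigma>"
          then have "\<sigma> y = \<sigma> u" using 2 u by (auto simp: perm_arcs_def)
          then show False using 2 permutes_inj[OF that] by (simp add: inj_eq)
        qed
        then show ?thesis
          using 2 u by (auto simp: permutations_of_set_def dest: list_arcs_injective)
      qed
      then show ?thesis by (simp only: card.empty)
    next
      case no: False
      have F': "F' \<subseteq> (V - {w}) \<times> (V - {w})"
        using less.prems(2) no w(2) by (auto simp: F'_def)
      have "acyclic F'" using less.prems(3) by (auto simp: F'_def intro: acyclic_subset)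
      moreover have "card (V - {w}) < card V"
        using uw less.prems(1) by (meson card_Diff1_less)
      ultimately have "card {xs \<in> permutations_of_set (V - {w}). F' \<subseteq> list_arcs xs}
          = card {\<sigma>. \<sigma> permutes (V - {w}) \<and> F' \<subseteq> perm_arcs (V - {w}) \<sigma>}"
        using less.hyps[of "V - {w}" F'] F' less.prems(1) by simp
      then show ?thesis
        unfolding F
        using card_lists_insert_arc[OF uw F'] card_perms_insert_arc[OF uw F'] no by simp
    qed
  qed
qed

section \<open>Signed sums over arc sets\<close>

text \<open>The sum is the expansion of the product of \<open>1 - 1\<close> over the elements of
  \<open>A\<close>.\<close>

lemma sum_alternating_Pow:
  assumes "finite A"
  shows "(\<Sum>F\<in>Pow A. (- 1) ^ card F) = (if A = {} then 1 else 0 :: int)"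
  using prod_diff_conv_sum[OF assms, of "\<lambda>_. 1 :: int" "\<lambda>_. 1"] assms
  by (simp add: power_0_left)

text \<open>The factor of a single cycle with arc set \<open>C\<close>. If
  \<open>C \<subseteq> A\<close>, the sum over all subsets is 0, and leaving out
  \<open>F = C\<close> leaves minus its sign. Otherwise \<open>\<not> C \<subseteq> F\<close> holds
  automatically and the full alternating sum over the subsets of \<open>A \<inter> C\<close>
  remains.\<close>

lemma sum_proper_subsets:
  assumes "finite C" "C \<noteq> {}"
  shows "(\<Sum>F | F \<subseteq> A \<inter> C \<and> \<not> C \<subseteq> F. (- 1) ^ card F)
       = (if C \<subseteq> A then (- 1) ^ (card C - 1) else if C \<inter> A = {} then 1 else 0 :: int)"
proof (cases "C \<subseteq> A")
  case True
  then have "{F. F \<subseteq> A \<inter> C \<and> \<not> C \<subseteq> F} = Pow C - {C}" by auto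
  moreover obtain n where "card C = Suc n"
    using assms by (metis card_0_eq not0_implies_Suc)
  ultimately show ?thesis
    using True assms by (simp add: sum_diff sum_alternating_Pow)
next
  case False
  then have "{F. F \<subseteq> A \<inter> C \<and> \<not> C \<subseteq> F} = Pow (A \<inter> C)" by auto
  then show ?thesis
    using False assms sum_alternating_Pow[of "A \<inter> C"] by (simp add: Int_commute del: Pow_Int_eq)
qed

text \<open>A subset of a disjoint union is an independent choice of its traces on the blocks. Signs
  multiply, and each avoidance condition concerns one trace only, so the sum factors.\<close>

lemma sum_subsets_avoiding_family:
  fixes C :: "'i \<Rightarrow> 'b set"
  assumes "finite I" "\<And>i. i \<in> I \<Longrightarrow> finite (C i) \<and> C i \<noteq> {}" "disjoint_family_on C I"
  shows "(\<Sum>F | F \<subseteq> A \<inter> (\<Union>i\<in>I. C i) \<and> (\<forall>i\<in>I. \<not> C i \<subseteq> F). (- 1) ^ card F)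
       = (\<Prod>i\<in>I. if C i \<subseteq> A then (- 1) ^ (card (C i) - 1)
                  else if C i \<inter> A = {} then 1 else 0 :: int)"
  using assms
proof (induction I rule: finite_induct)
  case empty
  have "{F. F = ({} :: 'b set)} = {{}}" by auto
  then show ?case by simp
next
  case (insert j I)
  let ?U = "\<Union>i\<in>I. C i"
  let ?X = "{F. F \<subseteq> A \<inter> C j \<and> \<not> C j \<subseteq> F}"
  let ?Y = "{F. F \<subseteq> A \<inter> ?U \<and> (\<forall>i\<in>I. \<not> C i \<subseteq> F)}"
  let ?Z = "{F. F \<subseteq> A \<inter> (\<Union>i\<in>insert j I. C i) \<and> (\<forall>i\<in>insert j I. \<not> C i \<subseteq> F)}"
  have fin: "finite (C j)" "finite ?U" using insert by auto
  have disj: "C j \<inter> ?U = {}"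
    using insert.prems(2) insert.hyps(2) by (auto simp: disjoint_family_on_def)
  have "(\<Sum>F\<in>?Z. (- 1) ^ card F)
      = (\<Sum>(F, G)\<in>?X \<times> ?Y. (- 1) ^ card F * (- 1) ^ card G :: int)"
  proof (rule sum.reindex_bij_witness
      [where i = "\<lambda>(F, G). F \<union> G" and j = "\<lambda>F. (F \<inter> C j, F \<inter> ?U)"])
    fix F assume F: "F \<in> ?Z"
    then have eq: "F = (F \<inter> C j) \<union> (F \<inter> ?U)" by auto
    then show "(case (F \<inter> C j, F \<inter> ?U) of (F, G) \<Rightarrow> F \<union> G) = F" by auto
    show "(F \<inter> C j, F \<inter> ?U) \<in> ?X \<times> ?Y" using F by auto
    have "card F = card (F \<inter> C j) + card (F \<inter> ?U)"
      by (subst eq, subst card_Un_disjoint) (use disj fin in auto)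
    then show "(case (F \<inter> C j, F \<inter> ?U) of (F, G) \<Rightarrow> (- 1) ^ card F * (- 1) ^ card G)
        = (- 1 :: int) ^ card F"
      by (simp add: power_add)
  next
    fix p assume "p \<in> ?X \<times> ?Y"
    then obtain F G where p: "p = (F, G)" and F: "F \<in> ?X" and G: "G \<in> ?Y" by auto
    have "(F \<union> G) \<inter> C j = F" "(F \<union> G) \<inter> ?U = G"
      using F G disj by blast+
    then show "((case p of (F, G) \<Rightarrow> F \<union> G) \<inter> C j, (case p of (F, G) \<Rightarrow> F \<union> G) \<inter> ?U) = p"
      by (simp add: p)
    \<comment> \<open>By disjointness a block inside \<open>F \<union> G\<close> would already lie
      inside \<open>F\<close> (if \<open>i = j\<close>) or inside \<open>G\<close>.\<close>
    have "\<not> C i \<subseteq> F \<union> G" if i: "i \<in> insert j I" for i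
    proof (cases "i = j")
      case True
      then show ?thesis using F G disj by blast
    next
      case False
      then have "i \<in> I" using i by simp
      then show ?thesis using F G disj by blast
    qed
    then show "(case p of (F, G) \<Rightarrow> F \<union> G) \<in> ?Z"
      using F G by (auto simp: p)
  qed
  also have "\<dots> = (\<Sum>F\<in>?X. (- 1) ^ card F) * (\<Sum>G\<in>?Y. (- 1) ^ card G)"
    by (simp add: sum.cartesian_product sum_product)
  also have "(\<Sum>G\<in>?Y. (- 1) ^ card G) = (\<Prod>i\<in>I. if C i \<subseteq> A then (- 1) ^ (card (C i) - 1)
                  else if C i \<inter> A = {} then 1 else 0 :: int)"
    using insert.prems by (intro insert.IH) (auto simp: disjoint_family_on_def)
  also have "(\<Sum>F\<in>?X. (- 1) ^ card F) = (if C j \<subseteq> A then (- 1) ^ (card (C j) - 1)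
                  else if C j \<inter> A = {} then 1 else 0 :: int)"
    using insert.prems by (intro sum_proper_subsets) auto
  finally show ?case using insert.hyps by simp
qed

section \<open>Cycles of a permutation\<close>

lemma rot_class_rotate1: "rot_class (rotate1 v) = rot_class v"
proof
  show "rot_class (rotate1 v) \<subseteq> rot_class v"
    by (auto simp: rot_class_def rotate1_rotate_swap intro: range_eqI[of _ _ "Suc _"])
  \<comment> \<open>A single rotation is undone by \<open>length v - 1\<close> more, which complete
    a full turn. For empty \<open>v\<close> the truncated difference is harmless.\<close>
  have "rotate n v = rotate (n + (length v - 1)) (rotate1 v)" for n
  proof (cases v)
    case (Cons a w)
    have "rotate (n + (length v - 1)) (rotate1 v) = rotate (n + length v) v"
      using Cons by (simp add: rotate1_rotate_swap[symmetric] del: rotate1.simps)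
    also have "\<dots> = rotate n v"
      by (simp flip: rotate_rotate)
    finally show ?thesis ..
  qed simp
  then show "rot_class v \<subseteq> rot_class (rotate1 v)"
    by (auto simp: rot_class_def)
qed

text \<open>At the last index the rotated list wraps around to \<open>i\<close>, which is the right
  value because \<open>Suc k\<close> is then the period of \<open>i\<close>.\<close>

lemma nth_rotate1_support:
  assumes "permutation \<sigma>" "k < least_power \<sigma> i"
  shows "rotate1 (support \<sigma> i) ! k = (\<sigma> ^^ Suc k) i"
proof (cases "Suc k = least_power \<sigma> i")
  case True
  then show ?thesis
    using assms least_power_of_permutation(1)[OF assms(1), of i] by (simp add: nth_rotate1)
next
  case False
  then show ?thesis using assms by (simp add: nth_rotate1)
qed

text \<open>Moving the starting point one step along its orbit keeps the period, since the injective
  \<open>\<sigma>\<close> can be cancelled, and rotates the list. Hence the rotation class depends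
  only on the orbit.\<close>

lemma support_apply:
  assumes "permutation \<sigma>"
  shows "support \<sigma> (\<sigma> i) = rotate1 (support \<sigma> i)"
proof -
  have inj: "inj \<sigma>" using assms by (simp add: bij_is_inj permutation_bijective)
  have "(\<sigma> ^^ n) (\<sigma> i) = \<sigma> i \<longleftrightarrow> (\<sigma> ^^ n) i = i" for n
    using inj by (metis funpow_swap1 injD)
  then have "least_power \<sigma> (\<sigma> i) = least_power \<sigma> i"
    by (simp add: least_power_def)
  then show ?thesis
    using assms by (intro nth_equalityI) (simp_all add: nth_rotate1_support funpow_swap1)
qed

lemma rot_class_support_funpow:
  assumes "permutation \<sigma>"
  shows "rot_class (support \<sigma> ((\<sigma> ^^ k) i)) = rot_class (support \<sigma> i)"
proof (induction k)
  case (Suc k)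
  have "rot_class (support \<sigma> (\<sigma> ((\<sigma> ^^ k) i))) = rot_class (support \<sigma> ((\<sigma> ^^ k) i))"
    by (subst support_apply[OF assms]) (rule rot_class_rotate1)
  then show ?case using Suc by (simp only: funpow.simps comp_apply)
qed simp

text \<open>Letting \<open>k\<close> run over all naturals, with repetitions, absorbs the closing
  arc and avoids indices modulo the period.\<close>

lemma CArcs_support:
  assumes "permutation \<sigma>"
  shows "CArcs (rot_class (support \<sigma> i)) = range (\<lambda>k. ((\<sigma> ^^ k) i, (\<sigma> ^^ Suc k) i))"
proof -
  have "CArcs (rot_class (support \<sigma> i))
      = {(support \<sigma> i ! k, rotate1 (support \<sigma> i) ! k) | k. k < least_power \<sigma> i}"
    by (simp add: CArcs_rot_class set_zip)
  also have "\<dots> = (\<lambda>x. (x, \<sigma> x)) ` set (support \<sigma> i)"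
    using nth_rotate1_support[OF assms] by force
  also have "\<dots> = range (\<lambda>k. ((\<sigma> ^^ k) i, (\<sigma> ^^ Suc k) i))"
    unfolding support_set[OF assms] by auto
  finally show ?thesis .
qed

text \<open>The entries of \<open>support \<sigma> i\<close> are distinct, so the arcs have distinct
  tails. This turns the exponents from block sizes into cycle lengths.\<close>

lemma card_CArcs_support:
  assumes "permutation \<sigma>"
  shows "card (CArcs (rot_class (support \<sigma> i))) = class_length (rot_class (support \<sigma> i))"
proof -
  have "distinct (zip (support \<sigma> i) (rotate1 (support \<sigma> i)))"
    using cycle_of_permutation[OF assms] by (rule distinct_zipI1)
  then show ?thesis
    by (simp add: CArcs_rot_class class_length_rot_class distinct_card)
qed

text \<open>Each vertex of \<open>V\<close> has exactly one outgoing arc in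
  \<open>perm_arcs V \<sigma>\<close>, so a closed walk in \<open>F\<close> must follow
  \<open>\<sigma>\<close> around a whole cycle.\<close>

lemma acyclic_iff_no_CArcs_subset:
  assumes "\<sigma> permutes V" "finite V" "F \<subseteq> perm_arcs V \<sigma>"
  shows "acyclic F \<longleftrightarrow> (\<forall>\<gamma>\<in>perm_cycles V \<sigma>. \<not> CArcs \<gamma> \<subseteq> F)"
proof -
  have perm: "permutation \<sigma>" using assms(1,2) by (auto simp: permutation_permutes)
  have "\<not> acyclic F" if "i \<in> V" and sub: "CArcs (rot_class (support \<sigma> i)) \<subseteq> F" for i
  proof -
    have arc: "((\<sigma> ^^ k) i, (\<sigma> ^^ Suc k) i) \<in> F" for k
      using sub unfolding CArcs_support[OF perm] by blast
    have "(i, (\<sigma> ^^ Suc k) i) \<in> F\<^sup>+" for k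
    proof (induction k)
      case 0
      then show ?case using arc[of 0] by auto
    next
      case (Suc k)
      then show ?case using arc[of "Suc k"] by (rule trancl_into_trancl)
    qed
    then have "(i, (\<sigma> ^^ least_power \<sigma> i) i) \<in> F\<^sup>+"
      using least_power_of_permutation(2)[OF perm, of i] by (metis Suc_pred)
    then show ?thesis
      using least_power_of_permutation(1)[OF perm, of i] by (auto simp: acyclic_def)
  qed
  moreover have "\<exists>i\<in>V. CArcs (rot_class (support \<sigma> i)) \<subseteq> F" if cyc: "\<not> acyclic F"
  proof -
    obtain i where i: "(i, i) \<in> F\<^sup>+" using cyc by (auto simp: acyclic_def)
    \<comment> \<open>Lying on a closed walk of \<open>F\<close> passes from \<open>x\<close> to
      \<open>\<sigma> x\<close>, so it propagates along the entire orbit.\<close>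
    have step: "(x, \<sigma> x) \<in> F \<and> (\<sigma> x, \<sigma> x) \<in> F\<^sup>+" if x: "(x, x) \<in> F\<^sup>+" for x
    proof -
      obtain z where z: "(x, z) \<in> F" "(z, x) \<in> F\<^sup>*" using x by (auto dest: tranclD)
      moreover have "z = \<sigma> x" using z assms(3) by (auto simp: perm_arcs_def)
      ultimately show ?thesis by (auto intro: rtrancl_into_trancl1)
    qed
    have "((\<sigma> ^^ k) i, (\<sigma> ^^ k) i) \<in> F\<^sup>+" for k
      by (induction k) (use i step in auto)
    then have "CArcs (rot_class (support \<sigma> i)) \<subseteq> F"
      unfolding CArcs_support[OF perm] using step by auto
    moreover have "i \<in> V" using step[OF i] assms(3) by (auto simp: perm_arcs_def)
    ultimately show ?thesis by blast
  qed
  ultimately show ?thesis by (auto simp: perm_cycles_def)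
qed

text \<open>A common arc has a common tail, so the two orbits meet and their rotation classes
  coincide.\<close>

lemma disjoint_CArcs:
  assumes "permutation \<sigma>"
  shows "disjoint_family_on CArcs (perm_cycles V \<sigma>)"
  unfolding disjoint_family_on_def
proof (intro ballI impI)
  fix \<gamma> \<delta> assume "\<gamma> \<in> perm_cycles V \<sigma>" "\<delta> \<in> perm_cycles V \<sigma>" "\<gamma> \<noteq> \<delta>"
  then obtain i j where ij: "\<gamma> = rot_class (support \<sigma> i)" "\<delta> = rot_class (support \<sigma> j)"
    unfolding perm_cycles_def by blast
  have "\<gamma> = \<delta>" if "(\<sigma> ^^ k) i = (\<sigma> ^^ l) j" for k l
    using rot_class_support_funpow[OF assms, of k i] rot_class_support_funpow[OF assms, of l j]
    by (simp only: ij that)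
  then show "CArcs \<gamma> \<inter> CArcs \<delta> = {}"
    using \<open>\<gamma> \<noteq> \<delta>\<close> unfolding ij CArcs_support[OF assms] by blast
qed

lemma UN_CArcs:
  assumes "\<sigma> permutes V" "finite V"
  shows "(\<Union>\<gamma>\<in>perm_cycles V \<sigma>. CArcs \<gamma>) = perm_arcs V \<sigma>"
proof -
  have perm: "permutation \<sigma>" using assms by (auto simp: permutation_permutes)
  have "(\<sigma> ^^ k) i \<in> V" if "i \<in> V" for i k
    using permutes_in_image[OF permutes_funpow[OF assms(1)]] that by simp
  then have "CArcs (rot_class (support \<sigma> i)) \<subseteq> perm_arcs V \<sigma>" if "i \<in> V" for i
    unfolding CArcs_support[OF perm] perm_arcs_def using that by auto
  moreover have "(i, \<sigma> i) \<in> CArcs (rot_class (support \<sigma> i))" for i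
    unfolding CArcs_support[OF perm] by (auto intro: range_eqI[of _ _ 0])
  ultimately show ?thesis
    unfolding perm_cycles_def perm_arcs_def by blast
qed

text \<open>For a cycle of a permutation, \<open>support \<sigma> i\<close> is itself a nonempty
  distinct representative inside the vertex set, so only the arc condition remains.\<close>

lemma digraph_cycle_iff:
  assumes "\<sigma> permutes pverts E" "finite (pverts E)" "\<gamma> \<in> perm_cycles (pverts E) \<sigma>"
  shows "digraph_cycle E \<gamma> \<longleftrightarrow> CArcs \<gamma> \<subseteq> parcs E"
proof -
  have perm: "permutation \<sigma>" using assms(1,2) by (auto simp: permutation_permutes)
  obtain i where i: "i \<in> pverts E" "\<gamma> = rot_class (support \<sigma> i)"
    using assms(3) by (auto simp: perm_cycles_def)
  have "set (support \<sigma> i) \<subseteq> pverts E"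
    using permutes_in_image[OF permutes_funpow[OF assms(1)]] i(1) by auto
  moreover have "support \<sigma> i \<noteq> []"
    using least_power_of_permutation(2)[OF perm, of i] by simp
  ultimately show ?thesis
    unfolding digraph_cycle_def using cycle_of_permutation[OF perm, of i] i(2) by blast
qed

lemma sum_acyclic_arcs_of_perm:
  assumes D: "pair_fin_digraph D" and \<sigma>: "\<sigma> permutes pverts D"
  shows "(\<Sum>F | F \<subseteq> parcs D \<inter> perm_arcs (pverts D) \<sigma> \<and> acyclic F. (- 1) ^ card F)
       = (if \<sigma> \<in> DDbar_perms D then (- 1) ^ phi D \<sigma> else 0 :: int)"
proof -
  let ?V = "pverts D" and ?A = "parcs D"
  let ?P = "perm_cycles ?V \<sigma>"
  have fin: "finite ?V" using D by (rule pair_fin_digraph.pair_finite_verts)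
  have perm: "permutation \<sigma>" using \<sigma> fin by (auto simp: permutation_permutes)
  have finP: "finite ?P" using fin by (simp add: perm_cycles_def)
  have finC: "finite (CArcs \<gamma>) \<and> CArcs \<gamma> \<noteq> {}" if "\<gamma> \<in> ?P" for \<gamma>
  proof -
    obtain i where i: "\<gamma> = rot_class (support \<sigma> i)"
      using \<open>\<gamma> \<in> ?P\<close> by (auto simp: perm_cycles_def)
    have "finite (CArcs \<gamma>)" unfolding i CArcs_rot_class by simp
    moreover have "CArcs \<gamma> \<noteq> {}" unfolding i CArcs_support[OF perm] by simp
    ultimately show ?thesis ..
  qed
  have cycD: "digraph_cycle D \<gamma> \<longleftrightarrow> CArcs \<gamma> \<subseteq> ?A" if "\<gamma> \<in> ?P" for \<gamma>
    using digraph_cycle_iff[OF \<sigma> fin that] .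
  \<comment> \<open>The arcs of \<open>\<gamma>\<close> lie in the square of the vertex set, so
    lying in the complement means avoiding \<open>?A\<close>.\<close>
  have cycC: "digraph_cycle (compl_digraph D) \<gamma> \<longleftrightarrow> CArcs \<gamma> \<inter> ?A = {}" if "\<gamma> \<in> ?P" for \<gamma>
  proof -
    have "CArcs \<gamma> \<subseteq> perm_arcs ?V \<sigma>" using UN_CArcs[OF \<sigma> fin] that by blast
    then have "CArcs \<gamma> \<subseteq> ?V \<times> ?V"
      using permutes_in_image[OF \<sigma>] by (auto simp: perm_arcs_def)
    then show ?thesis
      using digraph_cycle_iff[of \<sigma> "compl_digraph D" \<gamma>] \<sigma> fin that
      by (auto simp: compl_digraph_def)
  qed
  have "{F. F \<subseteq> ?A \<inter> perm_arcs ?V \<sigma> \<and> acyclic F}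
      = {F. F \<subseteq> ?A \<inter> (\<Union>\<gamma>\<in>?P. CArcs \<gamma>) \<and> (\<forall>\<gamma>\<in>?P. \<not> CArcs \<gamma> \<subseteq> F)}"
    using acyclic_iff_no_CArcs_subset[OF \<sigma> fin] UN_CArcs[OF \<sigma> fin] by auto
  then have "(\<Sum>F | F \<subseteq> ?A \<inter> perm_arcs ?V \<sigma> \<and> acyclic F. (- 1) ^ card F)
      = (\<Prod>\<gamma>\<in>?P. if CArcs \<gamma> \<subseteq> ?A then (- 1) ^ (card (CArcs \<gamma>) - 1)
                  else if CArcs \<gamma> \<inter> ?A = {} then 1 else 0 :: int)"
    by (simp only: sum_subsets_avoiding_family[OF finP finC disjoint_CArcs[OF perm]])
  also have "\<dots> = (\<Prod>\<gamma>\<in>?P. if digraph_cycle D \<gamma> then (- 1) ^ (class_length \<gamma> - 1)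
                  else if digraph_cycle (compl_digraph D) \<gamma> then 1 else 0)"
    using card_CArcs_support[OF perm]
    by (intro prod.cong refl) (auto simp: cycD cycC, auto simp: perm_cycles_def)
  also have "\<dots> = (if \<sigma> \<in> DDbar_perms D then (- 1) ^ phi D \<sigma> else 0)"
  \<comment> \<open>Inside \<open>DDbar_perms D\<close> only the \<open>D\<close>-cycles contribute
    signs, and their exponents add up to \<open>phi D \<sigma>\<close>. Outside it some cycle is of
    neither kind and its factor 0 kills the product.\<close>
  proof (cases "\<sigma> \<in> DDbar_perms D")
    case True
    then have "(\<Prod>\<gamma>\<in>?P. if digraph_cycle D \<gamma> then (- 1) ^ (class_length \<gamma> - 1)
                  else if digraph_cycle (compl_digraph D) \<gamma> then 1 else 0)
        = (\<Prod>\<gamma>\<in>?P. if digraph_cycle D \<gamma> then (- 1) ^ (class_length \<gamma> - 1) else 1 :: int)"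
      by (intro prod.cong) (auto simp: DDbar_perms_def)
    also have "\<dots> = (\<Prod>\<gamma> | \<gamma> \<in> ?P \<and> digraph_cycle D \<gamma>. (- 1) ^ (class_length \<gamma> - 1))"
      by (rule prod.inter_filter[OF finP, symmetric])
    also have "\<dots> = (- 1) ^ phi D \<sigma>"
      by (simp add: phi_def power_sum)
    finally show ?thesis using True by simp
  next
    case False
    then obtain \<gamma> where "\<gamma> \<in> ?P" "\<not> digraph_cycle D \<gamma>" "\<not> digraph_cycle (compl_digraph D) \<gamma>"
      using \<sigma> by (auto simp: DDbar_perms_def)
    then show ?thesis using False finP by (auto intro!: prod_zero bexI[of _ \<gamma>])
  qed
  finally show ?thesis .
qed

section \<open>Counting Hamiltonian paths of the complement\<close>

text \<open>A path through all vertices is an ordering of the vertex set. For no vertices the empty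
  list is the only ordering, matching the convention in \<open>hamp\<close>.\<close>

lemma hamps_compl_digraph:
  "{v. hamp (compl_digraph D) v}
     = {xs \<in> permutations_of_set (pverts D). parcs D \<inter> list_arcs xs = {}}"
proof (rule Collect_cong)
  fix v
  have "list_arcs v \<subseteq> pverts D \<times> pverts D" if "set v = pverts D"
    using list_arcs_subset[of v] that by simp
  then show "hamp (compl_digraph D) v
      \<longleftrightarrow> v \<in> permutations_of_set (pverts D) \<and> parcs D \<inter> list_arcs v = {}"
    by (cases "v = []")
      (auto simp: hamp_def compl_digraph_def vpath_def vwalk_def permutations_of_set_def)
qed

lemma card_hamps_compl_digraph:
  assumes D: "pair_fin_digraph D"
  shows "int (card {v. hamp (compl_digraph D) v}) = (\<Sum>\<sigma>\<in>DDbar_perms D. (- 1) ^ phi D \<sigma>)"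
proof -
  let ?V = "pverts D" and ?A = "parcs D"
  let ?L = "permutations_of_set ?V" and ?S = "{\<sigma>. \<sigma> permutes ?V}"
  interpret pair_fin_digraph D by fact
  have finV: "finite ?V" and finA: "finite ?A" by simp_all
  have AV: "?A \<subseteq> ?V \<times> ?V" using in_arcsD1 in_arcsD2 by force
  have finS: "finite ?S" using finV by (rule finite_permutations)
  have "int (card {v. hamp (compl_digraph D) v})
      = (\<Sum>xs\<in>?L. if ?A \<inter> list_arcs xs = {} then 1 else 0)"
    by (simp add: hamps_compl_digraph flip: sum.inter_filter)
  \<comment> \<open>The indicator of an empty intersection is expanded as an alternating sum over
    its subsets.\<close>
  also have "\<dots> = (\<Sum>xs\<in>?L. \<Sum>F\<in>Pow (?A \<inter> list_arcs xs). (- 1) ^ card F)"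
    using finA by (intro sum.cong refl) (simp add: sum_alternating_Pow del: Pow_Int_eq)
  \<comment> \<open>The range of \<open>F\<close> is made independent of \<open>xs\<close> so that
    the sums can be exchanged.\<close>
  also have "\<dots> = (\<Sum>xs\<in>?L. \<Sum>F\<in>Pow ?A. if F \<subseteq> list_arcs xs then (- 1) ^ card F else 0)"
    by (rule sum.cong[OF refl], subst sum.inter_filter[symmetric])
      (use finA in \<open>auto intro!: sum.cong\<close>)
  also have "\<dots> = (\<Sum>F\<in>Pow ?A. \<Sum>xs\<in>?L. if F \<subseteq> list_arcs xs then (- 1) ^ card F else 0)"
    by (rule sum.swap)
  \<comment> \<open>A cyclic \<open>F\<close> lies in no linear order but may lie in a permutation,
    so acyclicity becomes an explicit condition here.\<close>
  also have "\<dots> = (\<Sum>F\<in>Pow ?A. \<Sum>\<sigma>\<in>?S.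
      if F \<subseteq> perm_arcs ?V \<sigma> \<and> acyclic F then (- 1) ^ card F else 0)"
  proof (rule sum.cong[OF refl])
    fix F assume "F \<in> Pow ?A"
    then have FV: "F \<subseteq> ?V \<times> ?V" using AV by auto
    have "(\<Sum>xs\<in>?L. if F \<subseteq> list_arcs xs then (- 1) ^ card F else 0 :: int)
        = int (card {xs \<in> ?L. F \<subseteq> list_arcs xs}) * (- 1) ^ card F"
      by (simp flip: sum.inter_filter)
    also have "\<dots> = (if acyclic F
        then int (card {\<sigma> \<in> ?S. F \<subseteq> perm_arcs ?V \<sigma>}) * (- 1) ^ card F else 0)"
    proof (cases "acyclic F")
      case True
      then show ?thesis using card_lists_eq_card_perms[OF finV FV] by simp
    next
      case False
      then have "{xs \<in> ?L. F \<subseteq> list_arcs xs} = {}"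
        using acyclic_list_arcs acyclic_subset by (auto simp: permutations_of_set_def)
      then show ?thesis using False by (simp only: card.empty) simp
    qed
    also have "\<dots> = (\<Sum>\<sigma>\<in>?S.
        if F \<subseteq> perm_arcs ?V \<sigma> \<and> acyclic F then (- 1) ^ card F else 0)"
      using finS by (cases "acyclic F") (simp_all flip: sum.inter_filter)
    finally show "(\<Sum>xs\<in>?L. if F \<subseteq> list_arcs xs then (- 1) ^ card F else 0 :: int)
        = (\<Sum>\<sigma>\<in>?S. if F \<subseteq> perm_arcs ?V \<sigma> \<and> acyclic F then (- 1) ^ card F else 0)" .
  qed
  also have "\<dots> = (\<Sum>\<sigma>\<in>?S. \<Sum>F\<in>Pow ?A.
      if F \<subseteq> perm_arcs ?V \<sigma> \<and> acyclic F then (- 1) ^ card F else 0)"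
    by (rule sum.swap)
  also have "\<dots> = (\<Sum>\<sigma>\<in>?S. \<Sum>F | F \<subseteq> ?A \<inter> perm_arcs ?V \<sigma> \<and> acyclic F. (- 1) ^ card F)"
    by (rule sum.cong[OF refl], subst sum.inter_filter[symmetric])
      (use finA in \<open>auto intro!: sum.cong\<close>)
  also have "\<dots> = (\<Sum>\<sigma>\<in>?S. if \<sigma> \<in> DDbar_perms D then (- 1) ^ phi D \<sigma> else 0)"
    using sum_acyclic_arcs_of_perm[OF D] by (intro sum.cong) auto
  also have "\<dots> = (\<Sum>\<sigma>\<in>DDbar_perms D. (- 1) ^ phi D \<sigma>)"
    using finS by (subst sum.inter_filter[symmetric]) (auto simp: DDbar_perms_def intro!: sum.cong)
  finally show ?thesis .
qed

theorem theorem6p6: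
  fixes D :: "'a pair_pre_digraph"
  assumes "pair_fin_digraph D"
  shows "int (card {v. hamp (compl_digraph D) v}) = (\<Sum>\<sigma>\<in>DDbar_perms D. (- 1) ^ phi D \<sigma>)
    \<and> [card {v. hamp (compl_digraph D) v} = card (DDbar_perms D)] (mod 2)"
proof
  show a: "int (card {v. hamp (compl_digraph D) v}) = (\<Sum>\<sigma>\<in>DDbar_perms D. (- 1) ^ phi D \<sigma>)"
    using assms by (rule card_hamps_compl_digraph)
  \<comment> \<open>Part (b) is part (a) modulo 2, where every sign is 1.\<close>
  have "[(- 1) ^ n = 1] (mod 2 :: int)" for n
    by (cases "even n") (simp_all add: cong_def)
  then have "[(\<Sum>\<sigma>\<in>DDbar_perms D. (- 1) ^ phi D \<sigma>) = (\<Sum>\<sigma>\<in>DDbar_perms D. 1)] (mod 2 :: int)"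
    by (intro cong_sum)
  \<comment> \<open>The modulus is written \<open>int 2\<close> to match
    \<open>cong_int_iff\<close>, which carries the congruence back to the naturals.\<close>
  then have "[int (card {v. hamp (compl_digraph D) v}) = int (card (DDbar_perms D))] (mod int 2)"
    by (simp add: a)
  then show "[card {v. hamp (compl_digraph D) v} = card (DDbar_perms D)] (mod 2)"
    by (simp only: cong_int_iff)
qed

end
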